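(* Let $\mathcal{A} = (a_{i_1\cdots i_m})$ be a real $m$th order $n$-dimensional tensor. The following statements are equivalent: (i) $\mathcal{A}$ is strictly semi-positive. (ii) For every $\mathbf{q} \in \mathbb{R}^n$ with $\mathbf{q} \geq \mathbf{0}$, the tensor complementarity problem TCP $(\mathbf{q}, \mathcal{A})$ has a unique solution. (iii) For every nonempty index set $N \subset I_n$ (with $N = I_n$ allowed), the system $$\mathcal{A}^{|N|}(\mathbf{x}^N)^{m-1} \leq \mathbf{0}, \quad \mathbf{x}^N \geq \mathbf{0}, \quad \mathbf{x}^N \neq \mathbf{0}$$ has no solution $\mathbf{x}^N \in \mathbb{R}^{|N|}$.
   Context: $m,n$ are positive integers and $I_n = \{1,2,\dots,n\}$. A real $m$th order $n$-dimensional tensor is a multi-array $\mathcal{A} = (a_{i_1\cdots i_m})$ of real numbers with $i_j \in I_n$ for $j = 1,\dots,m$; no symmetry is assumed. For $\mathbf{x} \in \mathbb{R}^n$, $\mathcal{A}\mathbf{x}^{m-1} \in \mathbb{R}^n$ is the vector with components $(\mathcal{A}\mathbf{x}^{m-1})_i = \sum_{i_2,\dots,i_m=1}^n a_{i i_2\cdots i_m} x_{i_2}\cdots x_{i_m}$, $i \in I_n$. Vector inequalities are componentwise: $\mathbf{x} \geq \mathbf{0}$ means $x_i \geq 0$ for all $i$, and likewise $\leq \mathbf{0}$ means that every component is $\leq 0$. $\mathcal{A}$ is strictly semi-positive iff for each $\mathbf{x} \in \mathbb{R}^n$ with $\mathbf{x} \geq \mathbf{0}$ and $\mathbf{x} \neq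 \mathbf{0}$ there exists $k \in I_n$ such that $x_k > 0$ and $(\mathcal{A}\mathbf{x}^{m-1})_k > 0$. For $\mathbf{q} \in \mathbb{R}^n$, TCP $(\mathbf{q},\mathcal{A})$ is the problem: find $\mathbf{x} \in \mathbb{R}^n$ such that $\mathbf{x} \geq \mathbf{0}$, $\mathbf{q} + \mathcal{A}\mathbf{x}^{m-1} \geq \mathbf{0}$, and $\mathbf{x}^\top(\mathbf{q} + \mathcal{A}\mathbf{x}^{m-1}) = 0$. For a nonempty $N \subset I_n$, the principal sub-tensor $\mathcal{A}^{|N|}$ is the tensor of order $m$ and dimension $|N|$ consisting of the entries $a_{i_1\cdots i_m}$ with all $i_1,\dots,i_m \in N$. Vectors $\mathbf{x}^N \in \mathbb{R}^{|N|}$ are indexed by $N$, and $\big(\mathcal{A}^{|N|}(\mathbf{x}^N)^{m-1}\big)_i = \sum_{i_2,\dots,i_m \in N} a_{i i_2\cdots i_m} x^N_{i_2}\cdots x^N_{i_m}$ for $i \in N$. For $N = I_n$ this is $\mathcal{A}$ itself. *)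

theory Defs
  imports Complex_Main "HOL-Library.FuncSet"
begin

text \<open>
  Tensors and vectors are indexed by an arbitrary set \<open>N\<close> of naturals rather than by a type,
  so that a tensor (\<open>N = {1..n}\<close>) and its principal sub-tensors (\<open>N \<subseteq> {1..n}\<close>) are
  objects of the same kind. Functions are extensional, so that a vector or tensor is determined by
  its components and uniqueness of a vector means what it should.
\<close>

definition vectors :: "nat set \<Rightarrow> (nat \<Rightarrow> real) set" where
  "vectors N = N \<rightarrow>\<^sub>E UNIV"

definition zero_vector :: "nat set \<Rightarrow> nat \<Rightarrow> real" where
  "zero_vector N = (\<lambda>i\<in>N. 0)"

definition vector_le :: "nat set \<Rightarrow> (nat \<Rightarrow> real) \<Rightarrow> (nat \<Rightarrow> real) \<Rightarrow> bool" where
  "vector_le N x y \<longleftrightarrow> (\<forall>i\<in>N. x i \<le> y i)"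

definition vector_add :: "nat set \<Rightarrow> (nat \<Rightarrow> real) \<Rightarrow> (nat \<Rightarrow> real) \<Rightarrow> nat \<Rightarrow> real" where
  "vector_add N x y = (\<lambda>i\<in>N. x i + y i)"

definition dot_product :: "nat set \<Rightarrow> (nat \<Rightarrow> real) \<Rightarrow> (nat \<Rightarrow> real) \<Rightarrow> real" where
  "dot_product N x y = (\<Sum>i\<in>N. x i * y i)"

text \<open>The entry \<open>a\<close> with subscripts \<open>i\<^sub>1, \<dots>, i\<^sub>m\<close> is the value at the list \<open>[i\<^sub>1, \<dots>, i\<^sub>m]\<close>.\<close>

definition multi_indices :: "nat \<Rightarrow> nat set \<Rightarrow> nat list set" where
  "multi_indices m N = {js. set js \<subseteq> N \<and> length js = m}"

definition tensors :: "nat \<Rightarrow> nat set \<Rightarrow> (nat list \<Rightarrow> real) set" where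
  "tensors m N = multi_indices m N \<rightarrow>\<^sub>E UNIV"

definition principal_subtensor ::
    "nat \<Rightarrow> nat set \<Rightarrow> (nat list \<Rightarrow> real) \<Rightarrow> nat list \<Rightarrow> real" where
  "principal_subtensor m N A = restrict A (multi_indices m N)"

text \<open>
  The vector usually written \<open>A x\<close> to the power \<open>m - 1\<close>; the list \<open>js\<close> is \<open>[i\<^sub>2, \<dots>, i\<^sub>m]\<close>.
  For \<open>m = 1\<close> only the empty list contributes and the \<open>i\<close>-th component is \<open>A [i]\<close>.
\<close>

definition tensor_apply ::
    "nat \<Rightarrow> nat set \<Rightarrow> (nat list \<Rightarrow> real) \<Rightarrow> (nat \<Rightarrow> real) \<Rightarrow> nat \<Rightarrow> real" where
  "tensor_apply m N A x =
     (\<lambda>i\<in>N. \<Sum>js\<in>multi_indices (m - 1) N. A (i # js) * (\<Prod>j\<leftarrow>js. x j))"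

definition strictly_semi_positive :: "nat \<Rightarrow> nat set \<Rightarrow> (nat list \<Rightarrow> real) \<Rightarrow> bool" where
  "strictly_semi_positive m N A \<longleftrightarrow>
     (\<forall>x\<in>vectors N. vector_le N (zero_vector N) x \<and> x \<noteq> zero_vector N \<longrightarrow>
        (\<exists>k\<in>N. x k > 0 \<and> tensor_apply m N A x k > 0))"

definition tcp_solution ::
    "nat \<Rightarrow> nat set \<Rightarrow> (nat \<Rightarrow> real) \<Rightarrow> (nat list \<Rightarrow> real) \<Rightarrow> (nat \<Rightarrow> real) \<Rightarrow> bool" where
  "tcp_solution m N q A x \<longleftrightarrow>
     x \<in> vectors N \<and>
     vector_le N (zero_vector N) x \<and>
     vector_le N (zero_vector N) (vector_add N q (tensor_apply m N A x)) \<and>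
     dot_product N x (vector_add N q (tensor_apply m N A x)) = 0"

end

theory Submission imports Defs begin

text \<open>
  The argument rests on two facts about the support of a nonnegative vector \<open>x\<close>.

  Complementarity: for a nonnegative vector \<open>x\<close> and \<open>w = q + A x\<^sup>m\<^sup>-\<^sup>1 \<ge> 0\<close>, the inner product
  vanishes exactly if \<open>w\<close> vanishes on the support of \<open>x\<close>. If \<open>q \<ge> 0\<close>, then \<open>A x\<^sup>m\<^sup>-\<^sup>1 \<le> 0\<close> on
  the support of every solution \<open>x\<close>, and strict semi-positivity forbids this unless \<open>x = 0\<close>
  (\<open>tcp_solution_zero\<close>). Conversely, a nonzero \<open>x \<ge> 0\<close> with \<open>A x\<^sup>m\<^sup>-\<^sup>1 \<le> 0\<close> on its support solves
  the problem for a suitable \<open>q \<ge> 0\<close>: let \<open>q\<close> cancel \<open>A x\<^sup>m\<^sup>-\<^sup>1\<close> on the support and dominate it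
  elsewhere (\<open>witness_tcp_solution\<close>). The zero vector solves that problem as well, and
  uniqueness fails.

  Restriction: a term of \<open>A x\<^sup>m\<^sup>-\<^sup>1\<close> with a subscript outside the support of \<open>x\<close> contains a
  zero factor. For \<open>N\<close> containing the support, the components in \<open>N\<close> are therefore those of the
  principal sub-tensor on \<open>N\<close> applied to the restriction of \<open>x\<close>
  (\<open>tensor_apply_principal_subtensor\<close>). Extending a vector by zero, or restricting it to its
  support, translates between violations of strict semi-positivity and solutions of the system
  on a sub-tensor.

  The order \<open>m = 1\<close> is exceptional in that \<open>A x\<^sup>m\<^sup>-\<^sup>1\<close> is then a constant vector, so that the
  zero vector need not be mapped to zero. It still solves the problems above: strict
  semi-positivity, tested on the unit vectors, makes the constant positive; and in the
  converse the constant agrees with its value at the known solution \<open>x\<close>.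
\<close>

section \<open>Vectors and complementarity\<close>

lemma finite_multi_indices: "finite N \<Longrightarrow> finite (multi_indices m N)"
  unfolding multi_indices_def by (rule finite_lists_length_eq)

lemma zero_in_vectors: "zero_vector N \<in> vectors N"
  by (simp add: zero_vector_def vectors_def)

lemma zero_vector_apply: "i \<in> N \<Longrightarrow> zero_vector N i = 0"
  by (simp add: zero_vector_def)

lemma nonneg_iff: "vector_le N (zero_vector N) x \<longleftrightarrow> (\<forall>i\<in>N. 0 \<le> x i)"
  by (simp add: vector_le_def zero_vector_def)

lemma nonpos_iff: "vector_le N x (zero_vector N) \<longleftrightarrow> (\<forall>i\<in>N. x i \<le> 0)"
  by (simp add: vector_le_def zero_vector_def)

lemma nonzero_iff:
  assumes "x \<in> vectors N"
  shows "x \<noteq> zero_vector N \<longleftrightarrow> (\<exists>i\<in>N. x i \<noteq> 0)"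
proof -
  have "x = zero_vector N \<longleftrightarrow> (\<forall>i\<in>N. x i = zero_vector N i)"
    using assms zero_in_vectors[of N] unfolding vectors_def
    by (auto intro: PiE_ext)
  then show ?thesis
    by (simp add: zero_vector_apply)
qed

text \<open>The terms of the inner product are nonnegative, so it vanishes only if each of them does.\<close>

lemma tcp_solution_iff:
  assumes "finite N"
  shows "tcp_solution m N q A x \<longleftrightarrow> x \<in> vectors N \<and>
    (\<forall>i\<in>N. 0 \<le> x i \<and> 0 \<le> q i + tensor_apply m N A x i \<and>
       (0 < x i \<longrightarrow> q i + tensor_apply m N A x i = 0))"
    (is "?L \<longleftrightarrow> ?R")
proof -
  let ?w = "\<lambda>i. q i + tensor_apply m N A x i"
  have "?L \<longleftrightarrow> x \<in> vectors N \<and> (\<forall>i\<in>N. 0 \<le> x i) \<and> (\<forall>i\<in>N. 0 \<le> ?w i) \<and> (\<Sum>i\<in>N. x i * ?w i) = 0"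
    by (simp add: tcp_solution_def nonneg_iff vector_add_def dot_product_def)
  also have "\<dots> \<longleftrightarrow> x \<in> vectors N \<and> (\<forall>i\<in>N. 0 \<le> x i) \<and> (\<forall>i\<in>N. 0 \<le> ?w i) \<and> (\<forall>i\<in>N. x i * ?w i = 0)"
    using assms by (auto simp: sum_nonneg_eq_0_iff)
  also have "\<dots> \<longleftrightarrow> ?R"
    by (auto simp: order_le_less)
  finally show ?thesis .
qed

section \<open>Strict semi-positivity and uniqueness\<close>

lemma tensor_apply_order_1:
  "i \<in> N \<Longrightarrow> tensor_apply 1 N A x i = A [i]"
proof -
  have "multi_indices 0 N = {[]}"
    by (auto simp: multi_indices_def)
  then show "i \<in> N \<Longrightarrow> ?thesis"
    by (simp add: tensor_apply_def)
qed

text \<open>From order two on, each term of the sum has at least one factor from the vector.\<close>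

lemma tensor_apply_zero:
  assumes "2 \<le> m" "i \<in> N"
  shows "tensor_apply m N A (zero_vector N) i = 0"
proof -
  have "(\<Prod>j\<leftarrow>js. zero_vector N j) = 0" if "js \<in> multi_indices (m - 1) N" for js
    using that assms by (cases js) (auto simp: multi_indices_def zero_vector_apply)
  then show ?thesis
    using assms by (simp add: tensor_apply_def)
qed

lemma strictly_semi_positive_zero_nonneg:
  assumes "strictly_semi_positive m N A" "1 \<le> m" "i \<in> N"
  shows "0 \<le> tensor_apply m N A (zero_vector N) i"
proof (cases "m = 1")
  case True
  define e where "e = (\<lambda>j\<in>N. if j = i then 1 else 0 :: real)"
  have e: "e \<in> vectors N"
    by (simp add: e_def vectors_def)
  moreover have "e \<noteq> zero_vector N"
    using nonzero_iff[OF e] \<open>i \<in> N\<close> by (auto simp: e_def)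
  moreover have "vector_le N (zero_vector N) e"
    by (simp add: nonneg_iff e_def)
  ultimately obtain k where "k \<in> N" "e k > 0" "tensor_apply m N A e k > 0"
    using assms(1) unfolding strictly_semi_positive_def by blast
  moreover from this have "k = i"
    by (auto simp: e_def split: if_splits)
  ultimately show ?thesis
    using True by (simp only: tensor_apply_order_1 less_imp_le)
next
  case False
  then show ?thesis
    using assms by (simp add: tensor_apply_zero)
qed

lemma tcp_solution_zero:
  assumes "strictly_semi_positive m N A" "finite N" "\<forall>i\<in>N. 0 \<le> q i"
    and "tcp_solution m N q A x"
  shows "x = zero_vector N"
proof (rule ccontr)
  assume "x \<noteq> zero_vector N"
  with assms obtain k where "k \<in> N" "x k > 0" "tensor_apply m N A x k > 0"
    unfolding strictly_semi_positive_def tcp_solution_def by blast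
  moreover from this have "q k + tensor_apply m N A x k = 0"
    using assms by (simp add: tcp_solution_iff)
  ultimately show False
    using assms(3) by fastforce
qed

lemma strictly_semi_positive_ex1:
  assumes "strictly_semi_positive m N A" "finite N" "1 \<le> m" "\<forall>i\<in>N. 0 \<le> q i"
  shows "\<exists>!x. tcp_solution m N q A x"
proof
  show "tcp_solution m N q A (zero_vector N)"
    using assms strictly_semi_positive_zero_nonneg[OF assms(1,3)]
    by (simp add: tcp_solution_iff zero_in_vectors zero_vector_apply)
qed (use assms tcp_solution_zero in blast)

text \<open>
  On the support of \<open>x\<close> the vector \<open>q\<close> below is \<open>- A x\<^sup>m\<^sup>-\<^sup>1\<close>, as the image is nonpositive there.
  Off the support it only has to be large enough to make the sum nonnegative.
\<close>

lemma witness_tcp_solution: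
  assumes "finite N" "x \<in> vectors N" "\<forall>i\<in>N. 0 \<le> x i"
    and "\<forall>i\<in>N. 0 < x i \<longrightarrow> tensor_apply m N A x i \<le> 0"
  shows "tcp_solution m N (\<lambda>i\<in>N. \<bar>tensor_apply m N A x i\<bar>) A x"
  using assms by (auto simp: tcp_solution_iff)

lemma ex1_imp_strictly_semi_positive:
  assumes "finite N" "1 \<le> m"
    and unique: "\<And>q. q \<in> vectors N \<Longrightarrow> \<forall>i\<in>N. 0 \<le> q i \<Longrightarrow> \<exists>!x. tcp_solution m N q A x"
  shows "strictly_semi_positive m N A"
proof (rule ccontr)
  assume "\<not> strictly_semi_positive m N A"
  then obtain x where x: "x \<in> vectors N" "\<forall>i\<in>N. 0 \<le> x i" "x \<noteq> zero_vector N"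
    and neg: "\<forall>i\<in>N. 0 < x i \<longrightarrow> tensor_apply m N A x i \<le> 0"
    unfolding strictly_semi_positive_def nonneg_iff by (meson not_le)
  define q where "q = (\<lambda>i\<in>N. \<bar>tensor_apply m N A x i\<bar>)"
  have "q \<in> vectors N" "\<forall>i\<in>N. 0 \<le> q i"
    by (auto simp: q_def vectors_def)
  moreover have sol: "tcp_solution m N q A x"
    unfolding q_def using witness_tcp_solution assms(1) x neg by blast
  moreover have "tcp_solution m N q A (zero_vector N)"
  proof -
    have "0 \<le> q i + tensor_apply m N A (zero_vector N) i" if i: "i \<in> N" for i
    proof (cases "m = 1")
      case True
      have "tensor_apply m N A (zero_vector N) i = tensor_apply m N A x i"
        using i unfolding True by (simp only: tensor_apply_order_1)
      then show ?thesis
        using sol assms(1) i by (simp add: tcp_solution_iff)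
    next
      case False
      then show ?thesis
        using assms(2) i by (simp add: tensor_apply_zero q_def)
    qed
    then show ?thesis
      using assms(1) by (simp add: tcp_solution_iff zero_in_vectors zero_vector_apply)
  qed
  ultimately show False
    using unique x(3) by blast
qed

section \<open>Principal sub-tensors\<close>

lemma tensor_apply_principal_subtensor:
  assumes "finite M" "N \<subseteq> M" "1 \<le> m" "i \<in> N"
    and agree: "\<And>j. j \<in> N \<Longrightarrow> x j = y j" and vanish: "\<And>j. j \<in> M - N \<Longrightarrow> x j = 0"
  shows "tensor_apply m N (principal_subtensor m N A) y i = tensor_apply m M A x i"
proof -
  have "(\<Sum>js\<in>multi_indices (m - 1) N. principal_subtensor m N A (i # js) * (\<Prod>j\<leftarrow>js. y j))
      = (\<Sum>js\<in>multi_indices (m - 1) M. A (i # js) * (\<Prod>j\<leftarrow>js. x j))"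
  proof (rule sum.mono_neutral_cong_left)
    show "finite (multi_indices (m - 1) M)"
      using assms(1) by (rule finite_multi_indices)
    show "multi_indices (m - 1) N \<subseteq> multi_indices (m - 1) M"
      using assms(2) by (auto simp: multi_indices_def)
    show "\<forall>js\<in>multi_indices (m - 1) M - multi_indices (m - 1) N.
        A (i # js) * (\<Prod>j\<leftarrow>js. x j) = 0"
    proof
      fix js assume "js \<in> multi_indices (m - 1) M - multi_indices (m - 1) N"
      then obtain j where "j \<in> set js" "j \<in> M - N"
        by (auto simp: multi_indices_def)
      with vanish have "0 \<in> set (map x js)"
        by force
      then show "A (i # js) * (\<Prod>j\<leftarrow>js. x j) = 0"
        by (simp add: prod_list_zero_iff)
    qed
  next
    fix js assume js: "js \<in> multi_indices (m - 1) N"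
    then have "i # js \<in> multi_indices m N"
      using assms(3,4) by (auto simp: multi_indices_def)
    moreover have "map y js = map x js"
      using js agree by (auto simp: multi_indices_def)
    ultimately show "principal_subtensor m N A (i # js) * (\<Prod>j\<leftarrow>js. y j)
        = A (i # js) * (\<Prod>j\<leftarrow>js. x j)"
      by (simp add: principal_subtensor_def del: map_eq_conv)
  qed
  then show ?thesis
    using assms(2,4) by (auto simp: tensor_apply_def)
qed

text \<open>A solution on a sub-tensor, extended by zero, violates strict semi-positivity.\<close>

lemma strictly_semi_positive_subtensor:
  assumes "strictly_semi_positive m M A" "finite M" "1 \<le> m" "N \<subseteq> M"
    and y: "y \<in> vectors N" "\<forall>i\<in>N. 0 \<le> y i" "y \<noteq> zero_vector N"
  shows "\<exists>i\<in>N. 0 < tensor_apply m N (principal_subtensor m N A) y i"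
proof -
  define x where "x = (\<lambda>j\<in>M. if j \<in> N then y j else 0)"
  have x: "x \<in> vectors M"
    by (simp add: x_def vectors_def)
  have "\<exists>i\<in>M. x i \<noteq> 0"
    using y assms(4) by (force simp: x_def nonzero_iff)
  then have "x \<noteq> zero_vector M"
    using nonzero_iff[OF x] by blast
  moreover have "vector_le M (zero_vector M) x"
    using y(2) by (simp add: nonneg_iff x_def)
  ultimately obtain k where k: "k \<in> M" "0 < x k" "0 < tensor_apply m M A x k"
    using assms(1) x unfolding strictly_semi_positive_def by blast
  then have "k \<in> N"
    by (auto simp: x_def split: if_splits)
  moreover from this have
    "tensor_apply m N (principal_subtensor m N A) y k = tensor_apply m M A x k"
    using assms(2-4) by (intro tensor_apply_principal_subtensor) (auto simp: x_def)
  ultimately show ?thesis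
    using k(3) by (metis (no_types))
qed

text \<open>A violation of strict semi-positivity, restricted to its support, solves the system there.\<close>

lemma not_strictly_semi_positive_subtensor:
  assumes "\<not> strictly_semi_positive m M A" "finite M" "1 \<le> m"
  obtains N y where "N \<noteq> {}" "N \<subseteq> M" "y \<in> vectors N" "\<forall>i\<in>N. 0 \<le> y i" "y \<noteq> zero_vector N"
    "\<forall>i\<in>N. tensor_apply m N (principal_subtensor m N A) y i \<le> 0"
proof -
  obtain x where x: "x \<in> vectors M" "\<forall>i\<in>M. 0 \<le> x i" "x \<noteq> zero_vector M"
    and neg: "\<forall>i\<in>M. 0 < x i \<longrightarrow> tensor_apply m M A x i \<le> 0"
    using assms(1) unfolding strictly_semi_positive_def nonneg_iff by (meson not_le)
  define N where "N = {i\<in>M. 0 < x i}"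
  define y where "y = restrict x N"
  have sub: "N \<subseteq> M"
    by (auto simp: N_def)
  have y: "y \<in> vectors N"
    by (simp add: y_def vectors_def)
  have pos: "\<forall>i\<in>N. 0 < y i"
    by (simp add: y_def N_def)
  have ne: "N \<noteq> {}"
    using x by (force simp: N_def nonzero_iff)
  then obtain i where "i \<in> N"
    by blast
  then have "y \<noteq> zero_vector N"
    using nonzero_iff[OF y] pos by force
  moreover have "tensor_apply m N (principal_subtensor m N A) y i \<le> 0" if "i \<in> N" for i
  proof -
    have "x j = 0" if "j \<in> M - N" for j
      using that x(2) by (force simp: N_def)
    then have "tensor_apply m N (principal_subtensor m N A) y i = tensor_apply m M A x i"
      using assms(2,3) sub that
      by (intro tensor_apply_principal_subtensor) (auto simp: y_def)
    then show ?thesis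
      using neg that by (simp add: N_def)
  qed
  ultimately show thesis
    using that ne sub y pos by (meson less_imp_le)
qed

section \<open>The equivalence\<close>

theorem theorem3p2:
  fixes m n :: nat and A :: "nat list \<Rightarrow> real"
  assumes "m \<ge> 1" and "n \<ge> 1" and "A \<in> tensors m {1..n}"
  shows "(strictly_semi_positive m {1..n} A \<longleftrightarrow>
            (\<forall>q\<in>vectors {1..n}. vector_le {1..n} (zero_vector {1..n}) q \<longrightarrow>
               (\<exists>!x. tcp_solution m {1..n} q A x)))
       \<and> (strictly_semi_positive m {1..n} A \<longleftrightarrow>
            (\<forall>N. N \<noteq> {} \<and> N \<subseteq> {1..n} \<longrightarrow>
               \<not> (\<exists>x\<in>vectors N.
                    vector_le N (tensor_apply m N (principal_subtensor m N A) x) (zero_vector N) \<and>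
                    vector_le N (zero_vector N) x \<and>
                    x \<noteq> zero_vector N)))"
proof (intro conjI iffI)
  assume "strictly_semi_positive m {1..n} A"
  then show "\<forall>q\<in>vectors {1..n}. vector_le {1..n} (zero_vector {1..n}) q \<longrightarrow>
      (\<exists>!x. tcp_solution m {1..n} q A x)"
    using strictly_semi_positive_ex1 assms(1) by (simp add: nonneg_iff)
next
  assume "\<forall>q\<in>vectors {1..n}. vector_le {1..n} (zero_vector {1..n}) q \<longrightarrow>
      (\<exists>!x. tcp_solution m {1..n} q A x)"
  then show "strictly_semi_positive m {1..n} A"
    using assms(1) by (intro ex1_imp_strictly_semi_positive) (simp_all add: nonneg_iff)
next
  assume "strictly_semi_positive m {1..n} A"
  then show "\<forall>N. N \<noteq> {} \<and> N \<subseteq> {1..n} \<longrightarrow>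
      \<not> (\<exists>x\<in>vectors N.
           vector_le N (tensor_apply m N (principal_subtensor m N A) x) (zero_vector N) \<and>
           vector_le N (zero_vector N) x \<and> x \<noteq> zero_vector N)"
    using strictly_semi_positive_subtensor[OF _ finite_atLeastAtMost assms(1)]
    unfolding nonneg_iff nonpos_iff by (meson not_le)
next
  assume none: "\<forall>N. N \<noteq> {} \<and> N \<subseteq> {1..n} \<longrightarrow>
      \<not> (\<exists>x\<in>vectors N.
           vector_le N (tensor_apply m N (principal_subtensor m N A) x) (zero_vector N) \<and>
           vector_le N (zero_vector N) x \<and> x \<noteq> zero_vector N)"
  show "strictly_semi_positive m {1..n} A"
  proof (rule ccontr)
    assume "\<not> strictly_semi_positive m {1..n} A"
    then obtain N y where "N \<noteq> {}" "N \<subseteq> {1..n}" "y \<in> vectors N" "\<forall>i\<in>N. 0 \<le> y i"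
      "y \<noteq> zero_vector N" "\<forall>i\<in>N. tensor_apply m N (principal_subtensor m N A) y i \<le> 0"
      by (rule not_strictly_semi_positive_subtensor[OF _ finite_atLeastAtMost assms(1)])
    with none show False
      unfolding nonneg_iff nonpos_iff by blast
  qed
qed

end
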